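(* Let $L\ge2$ be an integer and $\sigma>0$. Let $\mathcal{L}=\{x_1,\dots,x_L\}\subset\mathbb{R}^n$ be an arbitrary set of $L$ points satisfying: (i) there is a constant $C>0$ independent of $n$ such that $\|x_i\|_2\le\sqrt{nC}$ for all $1\le i\le L$; (ii) there is a constant $c>0$ independent of $n$ such that $\|x_i-x_j\|_2\ge\sqrt{nc}$ for all $1\le i\ne j\le L$. Then $$P_{\mathrm{e},\mathrm{avg},L-1}^{\mathrm{ML}}(\mathcal{L})\;\ge\;\exp\left(-\frac{\mathrm{rad}^2(\mathcal{L})}{2\sigma^2}-o(n)\right).$$
   Context: $\mathrm{rad}^2(\mathcal{L})=\min_{y\in\mathbb{R}^n}\max_{x\in\mathcal{L}}\|x-y\|_2^2$ is the squared Chebyshev radius. Let $\mathbf{g}\sim\mathcal{N}(0,\sigma^2I_n)$ be a Gaussian vector in $\mathbb{R}^n$. For a set $\mathcal{L}$ of $L$ points and $x\in\mathcal{L}$, the probability of maximum-likelihood $(L-1)$-list-decoding error is $$P_{\mathrm{e},L-1}^{\mathrm{ML}}(x,\mathcal{L})=\Pr\left[\forall x'\in\mathcal{L}\setminus\{x\}:\ \|x'-(x+\mathbf{g})\|_2<\|\mathbf{g}\|_2\right],$$ and $P_{\mathrm{e},\mathrm{avg},L-1}^{\mathrm{ML}}(\mathcal{L})=\frac1L\sum_{x\in\mathcal{L}}P_{\mathrm{e},L-1}^{\mathrm{ML}}(x,\mathcal{L})$. The asymptotics are as $n\to\infty$ with $L,\sigma,C,c$ fixed; $o(n)$ is a quantity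 depending on $n,L,\sigma,C,c$ which divided by $n$ tends to $0$. *)

theory Defs
  imports "HOL-Probability.Probability" "HOL-Library.Landau_Symbols"
begin

text \<open>
  The dimension \<open>n\<close> tends to infinity inside the theorem, so it cannot be a type:
  \<open>\<real>\<^sup>n\<close> is the set of real functions on \<open>{..<n}\<close>, extended by \<^const>\<open>undefined\<close> outside
  (so that distinct functions are distinct points).  This is also the space of the product
  measure below.
\<close>

abbreviation euclid :: "nat \<Rightarrow> (nat \<Rightarrow> real) set" where
  "euclid n \<equiv> {..<n} \<rightarrow>\<^sub>E UNIV"

abbreviation norm2 :: "nat \<Rightarrow> (nat \<Rightarrow> real) \<Rightarrow> real" where
  "norm2 n v \<equiv> L2_set v {..<n}"

text \<open>
  The minimum over the centre \<open>y\<close> is written as an infimum; for finite nonempty \<open>S\<close> it is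
  attained, the maximum being continuous and coercive in \<open>y\<close>.
\<close>

definition rad_sq :: "nat \<Rightarrow> (nat \<Rightarrow> real) set \<Rightarrow> real" where
  "rad_sq n S = (INF y\<in>euclid n. Max ((\<lambda>x. (norm2 n (\<lambda>i. x i - y i))\<^sup>2) ` S))"

text \<open>The law \<open>N(0, \<sigma>\<^sup>2 I\<^sub>n)\<close>; \<^const>\<open>normal_density\<close> takes the standard deviation.\<close>

definition gaussian_vector :: "nat \<Rightarrow> real \<Rightarrow> (nat \<Rightarrow> real) measure" where
  "gaussian_vector n \<sigma> = (\<Pi>\<^sub>M i\<in>{..<n}. density lborel (normal_density 0 \<sigma>))"

definition P_ML :: "nat \<Rightarrow> real \<Rightarrow> (nat \<Rightarrow> real) \<Rightarrow> (nat \<Rightarrow> real) set \<Rightarrow> real" where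
  "P_ML n \<sigma> x S =
     measure (gaussian_vector n \<sigma>)
       {g \<in> space (gaussian_vector n \<sigma>).
          \<forall>x'\<in>S - {x}. norm2 n (\<lambda>i. x' i - (x i + g i)) < norm2 n g}"

definition P_ML_avg :: "nat \<Rightarrow> real \<Rightarrow> (nat \<Rightarrow> real) set \<Rightarrow> real" where
  "P_ML_avg n \<sigma> S = (1 / real (card S)) * (\<Sum>x\<in>S. P_ML n \<sigma> x S)"

end

theory Submission
  imports Defs "HOL-Real_Asymp.Real_Asymp"
begin

text \<open>
  The sum of the error probabilities over the transmitted point has a closed form.  Given a
  received vector \<open>z\<close>, decoding fails for the transmitted point \<open>x\<close> exactly when \<open>x\<close> is strictly
  further from \<open>z\<close> than every other point of \<open>S\<close>.  Almost every \<open>z\<close> has exactly one such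
  \<open>x\<close>, so with \<open>\<phi>\<close> the density of the noise, a decreasing function of the norm,
  \<open>\<Sum>\<^sub>x P(x) = \<integral> \<phi>(z - x(z)) dz = \<integral> min\<^sub>x \<phi>(z - x) dz\<close>,
  where \<open>x(z)\<close> is the point furthest from \<open>z\<close>.

  Now let \<open>y\<close> be a centre within squared distance \<open>R\<close> of all points, and put \<open>z = y + h\<close>.  Since
  \<open>|z - x|\<^sup>2 = |y - x|\<^sup>2 + 2 <h, y - x> + |h|\<^sup>2\<close>, the integral is at least
  \<open>exp (-R / 2\<sigma>\<^sup>2)\<close> times the expectation of \<open>exp (- max\<^sub>x <h, y - x> / \<sigma>\<^sup>2)\<close> for a Gaussian
  \<open>h\<close>.  By Jensen this expectation is at least \<open>exp (-m)\<close>, where \<open>m\<close> is the mean of the maximum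
  of \<open>L\<close> centred Gaussians of standard deviation \<open>|y - x| / \<sigma> = O(sqrt n)\<close>.  Hence \<open>m = O(sqrt n)\<close>,
  and the loss is \<open>o(n)\<close>.  The average costs a further factor \<open>1 / L\<close>.

  To avoid Lebesgue measure in dimension \<open>n\<close>, the substitution \<open>g = h + (y - x)\<close> is made under the
  Gaussian measure itself, by the Cameron-Martin formula (\<open>Cameron_Martin\<close>, used in \<open>P_ML_shift\<close>).
  That the weight in this formula has integral 1 also gives the moment generating
  function (\<open>gaussian_mgf\<close>), from which \<open>m\<close> is bounded.  Existence of a
  strictly furthest point is \<open>AE_furthest\<close>, and the pieces are combined in \<open>sum_P_ML_ge\<close>.
\<close>

section \<open>Translating a Gaussian vector\<close>

abbreviation gauss :: "real \<Rightarrow> real measure" where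
  "gauss \<sigma> \<equiv> density lborel (normal_density 0 \<sigma>)"

definition shift :: "nat \<Rightarrow> (nat \<Rightarrow> real) \<Rightarrow> (nat \<Rightarrow> real) \<Rightarrow> (nat \<Rightarrow> real)" where
  "shift n a h = (\<lambda>i\<in>{..<n}. h i + a i)"

text \<open>
  The density of \<open>N(-a, \<sigma>\<^sup>2 I)\<close> with respect to \<open>N(0, \<sigma>\<^sup>2 I)\<close>: the law that
  \<^const>\<open>shift\<close> by \<open>a\<close> carries to the centred one.
\<close>

definition tilt :: "nat \<Rightarrow> real \<Rightarrow> (nat \<Rightarrow> real) \<Rightarrow> (nat \<Rightarrow> real) \<Rightarrow> real" where
  "tilt n \<sigma> a h = exp (- (\<Sum>i<n. 2 * a i * h i + (a i)\<^sup>2) / (2 * \<sigma>\<^sup>2))"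

lemma norm2_sq: "(norm2 n v)\<^sup>2 = (\<Sum>i<n. (v i)\<^sup>2)"
  by (simp add: L2_set_def sum_nonneg)

lemma prob_space_gauss: "\<sigma> > 0 \<Longrightarrow> prob_space (gauss \<sigma>)"
  by (rule prob_space_normal_density)

lemma product_sigma_finite_gauss:
  assumes "\<sigma> > 0"
  shows "product_sigma_finite (\<lambda>_. gauss \<sigma>)"
  using prob_space_imp_sigma_finite[OF prob_space_gauss[OF assms]]
  by (simp add: product_sigma_finite_def)

lemma prob_space_gaussian_vector: "\<sigma> > 0 \<Longrightarrow> prob_space (gaussian_vector n \<sigma>)"
  unfolding gaussian_vector_def by (intro prob_space_PiM prob_space_gauss)

lemma measurable_component_gaussian [measurable]:
  "i \<in> {..<n} \<Longrightarrow> (\<lambda>h. h i) \<in> borel_measurable (gaussian_vector n \<sigma>)"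
  using measurable_component_singleton[of i "{..<n}" "\<lambda>_. gauss \<sigma>"]
  by (simp add: gaussian_vector_def cong: measurable_cong_sets)

lemma measurable_shift [measurable]:
  "shift n a \<in> gaussian_vector n \<sigma> \<rightarrow>\<^sub>M gaussian_vector n \<sigma>"
proof -
  have "(\<lambda>h. h i + a i) \<in> gaussian_vector n \<sigma> \<rightarrow>\<^sub>M gauss \<sigma>" if "i \<in> {..<n}" for i
    using that by (simp cong: measurable_cong_sets)
  then show ?thesis
    unfolding shift_def gaussian_vector_def[of n \<sigma>] by (intro measurable_restrict) auto
qed

lemma tilt_eq: "tilt n \<sigma> a h = exp (- ((\<Sum>i<n. a i * h i) / \<sigma>\<^sup>2) - (norm2 n a)\<^sup>2 / (2 * \<sigma>\<^sup>2))"
proof -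
  have "(\<Sum>i<n. 2 * a i * h i + (a i)\<^sup>2) = 2 * (\<Sum>i<n. a i * h i) + (norm2 n a)\<^sup>2"
    by (simp add: norm2_sq sum.distrib sum_distrib_left mult.assoc)
  then show ?thesis
    by (simp add: tilt_def diff_divide_distrib)
qed

lemma measurable_tilt [measurable]:
  "tilt n \<sigma> a \<in> borel_measurable (gaussian_vector n \<sigma>')"
  unfolding tilt_def by measurable

text \<open>
  Completing the square: the weight turns the density at \<open>h\<close> into the density at \<open>h + a\<close>, and
  Lebesgue measure on the line is translation invariant.
\<close>

lemma Cameron_Martin_1:
  assumes "\<sigma> > 0" and [measurable]: "A \<in> sets borel"
  shows "(\<integral>\<^sup>+h. ennreal (exp (- (2 * a * h + a\<^sup>2) / (2 * \<sigma>\<^sup>2))) * indicator A (h + a) \<partial>gauss \<sigma>)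
    = emeasure (gauss \<sigma>) A"
proof -
  have dens: "normal_density 0 \<sigma> h * exp (- (2 * a * h + a\<^sup>2) / (2 * \<sigma>\<^sup>2))
      = normal_density 0 \<sigma> (h + a)" for h
    by (simp add: normal_density_def exp_add[symmetric] add_divide_distrib[symmetric]
        diff_divide_distrib[symmetric] power2_eq_square algebra_simps)
  have "(\<integral>\<^sup>+h. ennreal (exp (- (2 * a * h + a\<^sup>2) / (2 * \<sigma>\<^sup>2))) * indicator A (h + a) \<partial>gauss \<sigma>)
      = (\<integral>\<^sup>+h. ennreal (normal_density 0 \<sigma> (h + a)) * indicator A (h + a) \<partial>lborel)"
    by (subst nn_integral_density)
      (auto simp: dens[symmetric] ennreal_mult mult.assoc normal_density_nonneg intro!: nn_integral_cong)
  also have "\<dots> = (\<integral>\<^sup>+h. ennreal (normal_density 0 \<sigma> h) * indicator A h \<partial>lborel)"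
    using nn_integral_real_affine[of "\<lambda>h. ennreal (normal_density 0 \<sigma> h) * indicator A h" 1 a]
    by (simp add: add.commute)
  also have "\<dots> = emeasure (gauss \<sigma>) A"
    by (simp add: emeasure_density)
  finally show ?thesis .
qed

text \<open>
  Both the weight and the indicator of a box factor over the coordinates, so the claim for boxes
  reduces to dimension one; a product measure is determined by its values on boxes.
\<close>

lemma Cameron_Martin:
  assumes \<sigma>: "\<sigma> > 0"
  shows "distr (density (gaussian_vector n \<sigma>) (tilt n \<sigma> a)) (gaussian_vector n \<sigma>) (shift n a)
    = gaussian_vector n \<sigma>"
proof -
  interpret product_sigma_finite "\<lambda>_::nat. gauss \<sigma>"
    by (rule product_sigma_finite_gauss[OF \<sigma>])
  let ?G = "gaussian_vector n \<sigma>"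
  let ?w = "\<lambda>i h. ennreal (exp (- (2 * a i * h + (a i)\<^sup>2) / (2 * \<sigma>\<^sup>2)))"
  have "distr (density ?G (tilt n \<sigma> a)) ?G (shift n a) = PiM {..<n} (\<lambda>_. gauss \<sigma>)"
  proof (rule PiM_eqI)
    show "sets (distr (density ?G (tilt n \<sigma> a)) ?G (shift n a))
        = sets (PiM {..<n} (\<lambda>_. gauss \<sigma>))"
      by (simp add: gaussian_vector_def)
  next
    fix A :: "nat \<Rightarrow> real set"
    assume A: "\<And>i. i \<in> {..<n} \<Longrightarrow> A i \<in> sets (gauss \<sigma>)"
    then have A': "i \<in> {..<n} \<Longrightarrow> A i \<in> sets borel" for i by simp
    have box[measurable]: "Pi\<^sub>E {..<n} A \<in> sets ?G"
      unfolding gaussian_vector_def using A by (intro sets_PiM_I_finite) auto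
    have split: "ennreal (tilt n \<sigma> a h) * indicator (Pi\<^sub>E {..<n} A) (shift n a h)
        = (\<Prod>i<n. ?w i (h i) * indicator (A i) (h i + a i))" for h
    proof -
      have "indicator (Pi\<^sub>E {..<n} A) (shift n a h)
          = (\<Prod>i<n. indicator (A i) (h i + a i) :: ennreal)"
        by (auto simp: indicator_def shift_def PiE_iff prod_zero_iff)
      moreover have "ennreal (tilt n \<sigma> a h) = (\<Prod>i<n. ?w i (h i))"
        unfolding tilt_def
        by (simp add: prod_ennreal exp_sum[symmetric] sum_negf sum_divide_distrib[symmetric]
            del: minus_add_distrib)
      ultimately show ?thesis by (simp add: prod.distrib)
    qed
    have "emeasure (distr (density ?G (tilt n \<sigma> a)) ?G (shift n a)) (Pi\<^sub>E {..<n} A)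
        = (\<integral>\<^sup>+h. indicator (Pi\<^sub>E {..<n} A) h \<partial>distr (density ?G (tilt n \<sigma> a)) ?G (shift n a))"
      by simp
    also have "\<dots> = (\<integral>\<^sup>+h. ennreal (tilt n \<sigma> a h) * indicator (Pi\<^sub>E {..<n} A) (shift n a h) \<partial>?G)"
      by (subst nn_integral_distr) (simp_all add: nn_integral_density)
    also have "\<dots> = (\<integral>\<^sup>+h. (\<Prod>i<n. ?w i (h i) * indicator (A i) (h i + a i))
        \<partial>PiM {..<n} (\<lambda>_. gauss \<sigma>))"
      by (simp only: split gaussian_vector_def)
    also have "\<dots> = (\<Prod>i<n. \<integral>\<^sup>+h. ?w i h * indicator (A i) (h + a i) \<partial>gauss \<sigma>)"
    proof (rule product_nn_integral_prod)
      fix i assume "i \<in> {..<n}"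
      note [measurable] = A'[OF this]
      have "(\<lambda>h. ?w i h * indicator (A i) (h + a i)) \<in> borel_measurable borel"
        by measurable
      then show "(\<lambda>h. ?w i h * indicator (A i) (h + a i)) \<in> borel_measurable (gauss \<sigma>)"
        by simp
    qed simp
    also have "\<dots> = (\<Prod>i<n. emeasure (gauss \<sigma>) (A i))"
      by (intro prod.cong refl Cameron_Martin_1 \<sigma> A')
    finally show "emeasure (distr (density ?G (tilt n \<sigma> a)) ?G (shift n a)) (Pi\<^sub>E {..<n} A)
        = (\<Prod>i<n. emeasure (gauss \<sigma>) (A i))" .
  qed simp
  then show ?thesis by (simp only: gaussian_vector_def)
qed

lemma integral_gaussian_shift:
  fixes f :: "(nat \<Rightarrow> real) \<Rightarrow> real"
  assumes "\<sigma> > 0" and [measurable]: "f \<in> borel_measurable (gaussian_vector n \<sigma>)"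
  shows "(\<integral>h. f h \<partial>gaussian_vector n \<sigma>)
    = (\<integral>h. tilt n \<sigma> a h * f (shift n a h) \<partial>gaussian_vector n \<sigma>)"
proof -
  have "(\<integral>h. f h \<partial>gaussian_vector n \<sigma>)
      = (\<integral>h. f h \<partial>distr (density (gaussian_vector n \<sigma>) (tilt n \<sigma> a)) (gaussian_vector n \<sigma>) (shift n a))"
    by (simp only: Cameron_Martin[OF assms(1)])
  also have "\<dots> = (\<integral>h. tilt n \<sigma> a h * f (shift n a h) \<partial>gaussian_vector n \<sigma>)"
    by (subst integral_distr, simp, simp, subst integral_density) (simp_all add: tilt_def)
  finally show ?thesis .
qed

lemma integral_tilt:
  assumes "\<sigma> > 0"
  shows "(\<integral>h. tilt n \<sigma> a h \<partial>gaussian_vector n \<sigma>) = 1"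
proof -
  interpret prob_space "gaussian_vector n \<sigma>"
    by (rule prob_space_gaussian_vector[OF assms])
  show ?thesis
    using integral_gaussian_shift[OF assms, of "\<lambda>_. 1" n a] by (simp add: prob_space)
qed

lemma integrable_tilt: "\<sigma> > 0 \<Longrightarrow> integrable (gaussian_vector n \<sigma>) (tilt n \<sigma> a)"
  using integral_tilt[of \<sigma> n a] not_integrable_integral_eq by force

text \<open>
  Up to the constant on the right, the integrand is the weight for the translation by \<open>-v\<close>,
  and that weight is a probability density.
\<close>

lemma gaussian_mgf:
  fixes v :: "nat \<Rightarrow> real"
  assumes \<sigma>: "\<sigma> > 0"
  shows "integrable (gaussian_vector n \<sigma>) (\<lambda>h. exp ((\<Sum>i<n. v i * h i) / \<sigma>\<^sup>2))"
    and "(\<integral>h. exp ((\<Sum>i<n. v i * h i) / \<sigma>\<^sup>2) \<partial>gaussian_vector n \<sigma>)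
      = exp ((norm2 n v)\<^sup>2 / (2 * \<sigma>\<^sup>2))"
proof -
  have eq: "exp ((\<Sum>i<n. v i * h i) / \<sigma>\<^sup>2)
      = exp ((norm2 n v)\<^sup>2 / (2 * \<sigma>\<^sup>2)) * tilt n \<sigma> (\<lambda>i. - v i) h" for h
    by (simp add: tilt_eq norm2_sq sum_negf exp_add[symmetric])
  show "integrable (gaussian_vector n \<sigma>) (\<lambda>h. exp ((\<Sum>i<n. v i * h i) / \<sigma>\<^sup>2))"
    unfolding eq by (intro integrable_mult_right integrable_tilt \<sigma>)
  show "(\<integral>h. exp ((\<Sum>i<n. v i * h i) / \<sigma>\<^sup>2) \<partial>gaussian_vector n \<sigma>)
      = exp ((norm2 n v)\<^sup>2 / (2 * \<sigma>\<^sup>2))"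
    unfolding eq by (simp add: integral_tilt[OF \<sigma>])
qed

section \<open>Almost every received vector has a strictly furthest point\<close>

text \<open>
  By Fubini in the coordinate \<open>j\<close>: once the other coordinates are fixed, the hyperplane
  contains a single value of the \<open>j\<close>-th one.
\<close>

lemma AE_gaussian_not_hyperplane:
  assumes \<sigma>: "\<sigma> > 0" and j: "j < n" "u j \<noteq> (0::real)"
  shows "AE h in gaussian_vector n \<sigma>. (\<Sum>i<n. u i * h i) \<noteq> b"
proof -
  interpret product_sigma_finite "\<lambda>_::nat. gauss \<sigma>"
    by (rule product_sigma_finite_gauss[OF \<sigma>])
  let ?G = "gaussian_vector n \<sigma>"
  define I where "I = {..<n} - {j}"
  have I: "finite I" "j \<notin> I" "{..<n} = insert j I"
    using j by (auto simp: I_def)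
  define T where "T = {h \<in> space ?G. (\<Sum>i<n. u i * h i) = b}"
  have T[measurable]: "T \<in> sets ?G"
    unfolding T_def by measurable
  have point: "emeasure (gauss \<sigma>) {p} = 0" for p
    by (simp add: emeasure_density nn_integral_indicator_singleton)
  have "emeasure ?G T = (\<integral>\<^sup>+h. indicator T h \<partial>PiM (insert j I) (\<lambda>_. gauss \<sigma>))"
    using T by (simp add: gaussian_vector_def I(3)[symmetric])
  also have "\<dots> = (\<integral>\<^sup>+x. \<integral>\<^sup>+y. indicator T (x(j := y)) \<partial>gauss \<sigma> \<partial>PiM I (\<lambda>_. gauss \<sigma>))"
    using T by (intro product_nn_integral_insert I borel_measurable_indicator)
      (simp add: gaussian_vector_def I(3)[symmetric])
  also have "\<dots> \<le> (\<integral>\<^sup>+x. \<integral>\<^sup>+y. indicator {(b - (\<Sum>i\<in>I. u i * x i)) / u j} y \<partial>gauss \<sigma>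
      \<partial>PiM I (\<lambda>_. gauss \<sigma>))"
  proof (intro nn_integral_mono)
    fix x y
    have "(\<Sum>i<n. u i * (x(j := y)) i) = u j * y + (\<Sum>i\<in>I. u i * x i)"
      unfolding I(3) using I(1,2) by (subst sum.insert) (auto intro!: sum.cong)
    then show "indicator T (x(j := y))
        \<le> (indicator {(b - (\<Sum>i\<in>I. u i * x i)) / u j} y :: ennreal)"
      using j(2) by (auto simp: indicator_def T_def field_simps)
  qed
  also have "\<dots> = 0"
    by (simp add: point)
  finally have "T \<in> null_sets ?G"
    using T by auto
  then show ?thesis
    by (rule AE_I'[OF _ ]) (auto simp: T_def)
qed

text \<open>
  The received vector is written as \<open>y + h\<close>, so that one and the same \<open>h\<close> can be compared for all
  transmitted points.
\<close>

definition strictly_furthest :: "nat \<Rightarrow> (nat \<Rightarrow> real) set \<Rightarrow> (nat \<Rightarrow> real) \<Rightarrow> (nat \<Rightarrow> real) \<Rightarrow> (nat \<Rightarrow> real) \<Rightarrow> bool" where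
  "strictly_furthest n S y x h \<longleftrightarrow>
     (\<forall>x'\<in>S - {x}. norm2 n (\<lambda>i. x' i - (y i + h i)) < norm2 n (\<lambda>i. x i - (y i + h i)))"

text \<open>
  A tie between two points puts \<open>h\<close> on their perpendicular bisector, a hyperplane since the
  points differ in some coordinate.  Off these finitely many null sets the distances are pairwise
  distinct, and the point at maximal distance is strictly furthest.
\<close>

lemma AE_furthest:
  assumes \<sigma>: "\<sigma> > 0" and S: "S \<subseteq> euclid n" "finite S" "S \<noteq> {}"
  shows "AE h in gaussian_vector n \<sigma>. \<exists>x\<in>S. strictly_furthest n S y x h"
proof -
  let ?d = "\<lambda>h x. norm2 n (\<lambda>i. x i - (y i + h i))"
  have "AE h in gaussian_vector n \<sigma>. ?d h x \<noteq> ?d h x'"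
    if x: "x \<in> S" "x' \<in> S" "x \<noteq> x'" for x x'
  proof -
    obtain j where j: "j < n" "x j \<noteq> x' j"
      using x S(1) PiE_ext[of x "{..<n}" "\<lambda>_. UNIV" x'] by blast
    have "AE h in gaussian_vector n \<sigma>. (\<Sum>i<n. 2 * (x' i - x i) * h i)
        \<noteq> (\<Sum>i<n. (x' i - y i)\<^sup>2) - (\<Sum>i<n. (x i - y i)\<^sup>2)"
      using j by (intro AE_gaussian_not_hyperplane[where j=j] \<sigma>) auto
    then show ?thesis
    proof eventually_elim
      case (elim h)
      have "(?d h x)\<^sup>2 - (?d h x')\<^sup>2 = (\<Sum>i<n. 2 * (x' i - x i) * h i)
          - ((\<Sum>i<n. (x' i - y i)\<^sup>2) - (\<Sum>i<n. (x i - y i)\<^sup>2))"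
        unfolding norm2_sq sum_subtractf[symmetric]
        by (intro sum.cong) (auto simp: power2_eq_square algebra_simps)
      with elim show ?case by auto
    qed
  qed
  then have "AE h in gaussian_vector n \<sigma>. \<forall>x\<in>S. \<forall>x'\<in>S. x \<noteq> x' \<longrightarrow> ?d h x \<noteq> ?d h x'"
    by (auto simp: AE_ball_countable S(2) countable_finite)
  then show ?thesis
  proof eventually_elim
    case (elim h)
    have "Max (?d h ` S) \<in> ?d h ` S"
      using S(2,3) by (intro Max_in) simp_all
    then obtain x where x: "x \<in> S" "?d h x = Max (?d h ` S)"
      by (elim imageE) simp
    have "?d h x' < ?d h x" if x': "x' \<in> S - {x}" for x'
    proof -
      have "?d h x' \<le> Max (?d h ` S)"
        using x' S(2) by (intro Max_ge) simp_all
      moreover have "?d h x' \<noteq> ?d h x"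
        using elim x(1) x' by blast
      ultimately show ?thesis using x(2) by linarith
    qed
    then have "strictly_furthest n S y x h"
      unfolding strictly_furthest_def by blast
    with x(1) show ?case by blast
  qed
qed

section \<open>The sum of the error probabilities\<close>

text \<open>
  Translating the noise by \<open>y - x\<close> moves the dependence on the transmitted point into the weight
  and the indicator.  After that the indicators of different points are alternatives for the same
  \<open>h\<close>, and can be added.
\<close>

lemma P_ML_shift:
  assumes \<sigma>: "\<sigma> > 0" and S: "finite S"
  shows "P_ML n \<sigma> x S = (\<integral>h. tilt n \<sigma> (\<lambda>i. y i - x i) h *
      of_bool (strictly_furthest n S y x h) \<partial>gaussian_vector n \<sigma>)"
    and "{h \<in> space (gaussian_vector n \<sigma>). strictly_furthest n S y x h} \<in> sets (gaussian_vector n \<sigma>)"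
proof -
  let ?G = "gaussian_vector n \<sigma>"
  define E where "E = {g \<in> space ?G. \<forall>x'\<in>S - {x}. norm2 n (\<lambda>i. x' i - (x i + g i)) < norm2 n g}"
  have fin: "finite (S - {x})" using S by simp
  have [measurable]: "E \<in> sets ?G"
    unfolding E_def L2_set_def by (intro sets.sets_Collect_finite_All fin) measurable
  show "{h \<in> space ?G. strictly_furthest n S y x h} \<in> sets ?G"
    unfolding strictly_furthest_def L2_set_def by (intro sets.sets_Collect_finite_All fin) measurable
  have event: "indicator E (shift n (\<lambda>i. y i - x i) h) = (of_bool (strictly_furthest n S y x h) :: real)"
    if "h \<in> space ?G" for h
  proof -
    have "shift n (\<lambda>i. y i - x i) h \<in> space ?G"
      using measurable_space[OF measurable_shift that] .
    moreover have "norm2 n (\<lambda>i. x' i - (x i + shift n (\<lambda>i. y i - x i) h i))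
        = norm2 n (\<lambda>i. x' i - (y i + h i))" for x'
      by (intro L2_set_cong) (auto simp: shift_def)
    moreover have "norm2 n (shift n (\<lambda>i. y i - x i) h) = norm2 n (\<lambda>i. x i - (y i + h i))"
      unfolding L2_set_def
      by (intro arg_cong[where f=sqrt] sum.cong) (auto simp: shift_def power2_eq_square algebra_simps)
    ultimately show ?thesis
      by (simp add: E_def strictly_furthest_def indicator_def)
  qed
  have "P_ML n \<sigma> x S = (\<integral>h. indicator E h \<partial>?G)"
    by (simp add: P_ML_def E_def[symmetric])
  also have "\<dots> = (\<integral>h. tilt n \<sigma> (\<lambda>i. y i - x i) h * indicator E (shift n (\<lambda>i. y i - x i) h) \<partial>?G)"
    by (rule integral_gaussian_shift[OF \<sigma>]) simp
  also have "\<dots> = (\<integral>h. tilt n \<sigma> (\<lambda>i. y i - x i) h * of_bool (strictly_furthest n S y x h) \<partial>?G)"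
    by (intro Bochner_Integration.integral_cong refl) (simp add: event)
  finally show "P_ML n \<sigma> x S = \<dots>" .
qed

text \<open>Jensen's inequality, from the tangent line of \<open>exp\<close> at minus the mean of \<open>Q\<close>.\<close>

lemma (in prob_space) exp_expectation_le:
  assumes "integrable M Q" "integrable M (\<lambda>h. exp (- Q h))"
  shows "exp (- expectation Q) \<le> expectation (\<lambda>h. exp (- Q h :: real))"
proof -
  let ?m = "expectation Q"
  have "exp (- ?m) = expectation (\<lambda>h. exp (- ?m) * (1 + (?m - Q h)))"
    using assms(1) by (simp add: prob_space)
  also have "\<dots> \<le> expectation (\<lambda>h. exp (- Q h))"
  proof (intro integral_mono assms(2))
    fix h
    have "exp (- ?m) * (1 + (?m - Q h)) \<le> exp (- ?m) * exp (?m - Q h)"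
      by (intro mult_left_mono exp_ge_add_one_self) simp
    then show "exp (- ?m) * (1 + (?m - Q h)) \<le> exp (- Q h)"
      by (simp add: exp_add[symmetric])
  qed (use assms(1) in simp)
  finally show ?thesis .
qed

text \<open>
  The maximum of \<open>t\<^sub>x = <h, y - x> / \<sigma>\<^sup>2\<close> over \<open>x\<close> is replaced by the larger
  \<open>Q h = \<Sum>\<^sub>x A exp (t\<^sub>x / A)\<close>, whose mean \<open>gaussian_mgf\<close> computes.  The scale \<open>A\<close> is free: with
  \<open>A\<^sup>2\<close> of the order of \<open>R\<close> the exponents stay bounded and the mean is \<open>O(A)\<close>.
\<close>

lemma sum_P_ML_ge:
  assumes \<sigma>: "\<sigma> > 0" and A: "A > 0"
    and S: "S \<subseteq> euclid n" "finite S" "S \<noteq> {}"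
    and R: "\<And>x. x \<in> S \<Longrightarrow> (norm2 n (\<lambda>i. x i - y i))\<^sup>2 \<le> R"
  shows "exp (- (R / (2 * \<sigma>\<^sup>2)) - real (card S) * A * exp (R / (2 * \<sigma>\<^sup>2 * A\<^sup>2)))
    \<le> (\<Sum>x\<in>S. P_ML n \<sigma> x S)"
proof -
  let ?G = "gaussian_vector n \<sigma>"
  interpret prob_space ?G by (rule prob_space_gaussian_vector[OF \<sigma>])
  let ?a = "\<lambda>x i. y i - x i"
  let ?F = "\<lambda>x h. tilt n \<sigma> (?a x) h * of_bool (strictly_furthest n S y x h) :: real"
  let ?e = "\<lambda>x h. exp ((\<Sum>i<n. (?a x i / A) * h i) / \<sigma>\<^sup>2)"
  define Q where "Q h = (\<Sum>x\<in>S. A * ?e x h)" for h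
  have Q_nonneg: "Q h \<ge> 0" for h
    unfolding Q_def using A by (intro sum_nonneg) simp
  have Q_int: "integrable ?G Q"
    unfolding Q_def[abs_def]
    by (intro Bochner_Integration.integrable_sum integrable_mult_right gaussian_mgf(1) \<sigma>)
  have [measurable]: "Q \<in> borel_measurable ?G"
    using Q_int by auto
  have eQ_int: "integrable ?G (\<lambda>h. exp (- Q h))"
    by (rule integrable_const_bound[where B=1]) (auto simp: Q_nonneg)
  have nrm: "(norm2 n (\<lambda>i. ?a x i / A))\<^sup>2 \<le> R / A\<^sup>2" if "x \<in> S" for x
    using R[OF that] A unfolding norm2_sq
    by (simp add: power_divide sum_divide_distrib[symmetric] divide_right_mono power2_commute)
  have "expectation Q = (\<Sum>x\<in>S. A * exp ((norm2 n (\<lambda>i. ?a x i / A))\<^sup>2 / (2 * \<sigma>\<^sup>2)))"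
    unfolding Q_def
    by (subst Bochner_Integration.integral_sum)
      (simp_all add: gaussian_mgf[OF \<sigma>] del: times_divide_eq_left)
  also have "\<dots> \<le> (\<Sum>x\<in>S. A * exp (R / (2 * \<sigma>\<^sup>2 * A\<^sup>2)))"
  proof (intro sum_mono mult_left_mono)
    fix x assume "x \<in> S"
    from divide_right_mono[OF nrm[OF this], of "2 * \<sigma>\<^sup>2"]
    show "exp ((norm2 n (\<lambda>i. ?a x i / A))\<^sup>2 / (2 * \<sigma>\<^sup>2)) \<le> exp (R / (2 * \<sigma>\<^sup>2 * A\<^sup>2))"
      by (simp add: mult.commute)
  qed (use A in simp)
  finally have EQ: "expectation Q \<le> real (card S) * A * exp (R / (2 * \<sigma>\<^sup>2 * A\<^sup>2))"
    by simp
  have F_int: "integrable ?G (?F x)" for x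
  proof -
    have "integrable ?G (\<lambda>h. tilt n \<sigma> (?a x) h *
        indicator {h \<in> space ?G. strictly_furthest n S y x h} h)"
      by (intro integrable_real_mult_indicator P_ML_shift(2) integrable_tilt \<sigma> S)
    then show ?thesis
      by (rule Bochner_Integration.integrable_cong[THEN iffD1, rotated 2]) (auto simp: indicator_def)
  qed
  have tilt_ge: "exp (- (R / (2 * \<sigma>\<^sup>2))) * exp (- Q h) \<le> tilt n \<sigma> (?a x) h"
    if "x \<in> S" for x h
  proof -
    define t where "t = (\<Sum>i<n. ?a x i * h i) / \<sigma>\<^sup>2"
    have "t / A \<le> exp (t / A)"
      using exp_ge_add_one_self[of "t / A"] by linarith
    then have "t \<le> A * exp (t / A)"
      using A by (simp add: field_simps)
    also have "t / A = (\<Sum>i<n. (?a x i / A) * h i) / \<sigma>\<^sup>2"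
      by (simp add: t_def sum_divide_distrib mult.commute)
    also have "A * ?e x h \<le> Q h"
      unfolding Q_def using A S(2) that by (intro member_le_sum) auto
    finally have t: "t \<le> Q h" .
    have "tilt n \<sigma> (?a x) h = exp (- t - (norm2 n (\<lambda>i. x i - y i))\<^sup>2 / (2 * \<sigma>\<^sup>2))"
      by (simp add: tilt_eq t_def norm2_sq power2_commute)
    moreover have "(norm2 n (\<lambda>i. x i - y i))\<^sup>2 / (2 * \<sigma>\<^sup>2) \<le> R / (2 * \<sigma>\<^sup>2)"
      by (intro divide_right_mono R that) simp
    ultimately show ?thesis
      using t by (simp add: exp_add[symmetric])
  qed
  have "exp (- (R / (2 * \<sigma>\<^sup>2)) - real (card S) * A * exp (R / (2 * \<sigma>\<^sup>2 * A\<^sup>2)))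
      \<le> exp (- (R / (2 * \<sigma>\<^sup>2))) * exp (- expectation Q)"
    using EQ by (simp add: exp_add[symmetric])
  also have "\<dots> \<le> exp (- (R / (2 * \<sigma>\<^sup>2))) * expectation (\<lambda>h. exp (- Q h))"
    by (intro mult_left_mono exp_expectation_le Q_int eQ_int) simp
  also have "\<dots> = expectation (\<lambda>h. exp (- (R / (2 * \<sigma>\<^sup>2))) * exp (- Q h))"
    by simp
  also have "\<dots> \<le> expectation (\<lambda>h. \<Sum>x\<in>S. ?F x h)"
  proof (intro integral_mono_AE Bochner_Integration.integrable_sum F_int integrable_mult_right eQ_int)
    show "AE h in ?G. exp (- (R / (2 * \<sigma>\<^sup>2))) * exp (- Q h) \<le> (\<Sum>x\<in>S. ?F x h)"
      using AE_furthest[OF \<sigma> S, of y]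
    proof eventually_elim
      case (elim h)
      then obtain x where x: "x \<in> S" "strictly_furthest n S y x h" by blast
      have "?F x h \<le> (\<Sum>x\<in>S. ?F x h)"
        using S(2) x(1) by (intro member_le_sum) (auto simp: tilt_def)
      with tilt_ge[OF x(1), of h] x(2) show ?case by simp
    qed
  qed
  also have "\<dots> = (\<Sum>x\<in>S. P_ML n \<sigma> x S)"
    by (subst Bochner_Integration.integral_sum)
      (simp_all only: F_int P_ML_shift(1)[OF \<sigma> S(2), where y=y])
  finally show ?thesis .
qed

section \<open>The Chebyshev radius\<close>

text \<open>
  A centre attaining the infimum up to a constant is enough, as a constant is absorbed
  in \<open>o(n)\<close>.  The bound by \<open>K\<close> comes from comparison with the centre \<open>0\<close>.
\<close>

lemma near_optimal_centre:
  assumes S: "finite S" "S \<noteq> {}"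
    and N: "\<And>x. x \<in> S \<Longrightarrow> (norm2 n x)\<^sup>2 \<le> K"
    and "\<epsilon> > 0"
  obtains y R where "\<And>x. x \<in> S \<Longrightarrow> (norm2 n (\<lambda>i. x i - y i))\<^sup>2 \<le> R"
    and "R \<le> rad_sq n S + \<epsilon>" and "R \<le> K + \<epsilon>"
proof -
  let ?f = "\<lambda>y. Max ((\<lambda>x. (norm2 n (\<lambda>i. x i - y i))\<^sup>2) ` S)"
  define R where "R = rad_sq n S + \<epsilon>"
  have ne: "euclid n \<noteq> {}" by (simp add: PiE_eq_empty_iff)
  have bdd: "bdd_below (?f ` euclid n)"
  proof (rule bdd_belowI2)
    fix y
    obtain x where "x \<in> S" using S by blast
    then have "(norm2 n (\<lambda>i. x i - y i))\<^sup>2 \<le> ?f y"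
      using S by (intro Max_ge) auto
    then show "0 \<le> ?f y"
      by (rule order_trans[OF zero_le_power2])
  qed
  have "rad_sq n S \<le> ?f (\<lambda>i\<in>{..<n}. 0)"
    unfolding rad_sq_def by (intro cINF_lower bdd restrict_PiE[THEN iffD2]) simp
  also have "\<dots> \<le> K"
  proof (intro Max.boundedI)
    fix v assume "v \<in> (\<lambda>x. (norm2 n (\<lambda>i. x i - (\<lambda>i\<in>{..<n}. 0) i))\<^sup>2) ` S"
    then obtain x where x: "x \<in> S" "v = (norm2 n (\<lambda>i. x i - (\<lambda>i\<in>{..<n}. 0) i))\<^sup>2" by blast
    then have "v = (norm2 n x)\<^sup>2" by (simp add: norm2_sq)
    with N[OF x(1)] show "v \<le> K" by simp
  qed (use S in auto)
  finally have RK: "R \<le> K + \<epsilon>" by (simp add: R_def)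
  have "Inf (?f ` euclid n) < R"
    using \<open>\<epsilon> > 0\<close> by (simp add: R_def rad_sq_def)
  then obtain y where "?f y < R"
    using cINF_less_iff[OF ne bdd] by blast
  then have "(norm2 n (\<lambda>i. x i - y i))\<^sup>2 \<le> R" if "x \<in> S" for x
    using that S Max_ge[of "(\<lambda>x. (norm2 n (\<lambda>i. x i - y i))\<^sup>2) ` S" "(norm2 n (\<lambda>i. x i - y i))\<^sup>2"]
    by fastforce
  then show ?thesis
    using that[of y R] RK by (simp add: R_def)
qed

theorem mainTheorem3:
  fixes L :: nat and \<sigma> C c :: real
  assumes "L \<ge> 2" and "\<sigma> > 0" and "C > 0" and "c > 0"
  shows "\<exists>r :: nat \<Rightarrow> real. r \<in> o(\<lambda>n. real n) \<and>
    (\<forall>(n::nat) (S :: (nat \<Rightarrow> real) set).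
       S \<subseteq> euclid n \<longrightarrow> finite S \<longrightarrow> card S = L \<longrightarrow>
       (\<forall>x\<in>S. norm2 n x \<le> sqrt (real n * C)) \<longrightarrow>
       (\<forall>x\<in>S. \<forall>x'\<in>S. x \<noteq> x' \<longrightarrow> norm2 n (\<lambda>i. x i - x' i) \<ge> sqrt (real n * c)) \<longrightarrow>
       P_ML_avg n \<sigma> S \<ge> exp (- (rad_sq n S / (2 * \<sigma>\<^sup>2)) - r n))"
proof -
  \<comment> \<open>\<open>ln L\<close> pays for the averaging, \<open>1 / 2\<sigma>\<^sup>2\<close> for a centre that misses the infimum of the
    squared radius by 1, and the last term for Jensen's inequality.\<close>
  define r where "r n = (ln (real L) + 1 / (2 * \<sigma>\<^sup>2))
      + real L * exp ((C + 1) / (2 * \<sigma>\<^sup>2)) * sqrt (real n + 1)" for n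
  have "r \<in> o(\<lambda>n. real n)"
  proof -
    have "(\<lambda>n. sqrt (real n + 1)) \<in> o(\<lambda>n. real n)"
      by real_asymp
    then have "(\<lambda>n. real L * exp ((C + 1) / (2 * \<sigma>\<^sup>2)) * sqrt (real n + 1)) \<in> o(\<lambda>n. real n)"
      by simp
    moreover have "(\<lambda>n::nat. ln (real L) + 1 / (2 * \<sigma>\<^sup>2)) \<in> o(\<lambda>n. real n)"
      by real_asymp
    ultimately show ?thesis
      unfolding r_def[abs_def] by (rule sum_in_smallo(1)[rotated])
  qed
  moreover have "exp (- (rad_sq n S / (2 * \<sigma>\<^sup>2)) - r n) \<le> P_ML_avg n \<sigma> S"
    if S: "S \<subseteq> euclid n" "finite S" "card S = L"
      and nrm: "\<forall>x\<in>S. norm2 n x \<le> sqrt (real n * C)" for n S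
  proof -
    have "S \<noteq> {}" using S \<open>L \<ge> 2\<close> by auto
    have "(norm2 n x)\<^sup>2 \<le> real n * C" if "x \<in> S" for x
      using power_mono[OF bspec[OF nrm that], of 2] \<open>C > 0\<close> by simp
    from near_optimal_centre[OF S(2) \<open>S \<noteq> {}\<close> this zero_less_one]
    obtain y R where R: "\<And>x. x \<in> S \<Longrightarrow> (norm2 n (\<lambda>i. x i - y i))\<^sup>2 \<le> R"
      "R \<le> rad_sq n S + 1" "R \<le> real n * C + 1" by metis
    \<comment> \<open>The summand 1 keeps \<open>A\<close> positive in dimension 0.\<close>
    define A where "A = sqrt (real n + 1)"
    have A: "A > 0" "A\<^sup>2 = real n + 1" by (auto simp: A_def)
    have "R / (2 * \<sigma>\<^sup>2 * A\<^sup>2) = (R / A\<^sup>2) / (2 * \<sigma>\<^sup>2)"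
      by simp
    also have "\<dots> \<le> (C + 1) / (2 * \<sigma>\<^sup>2)"
    proof (rule divide_right_mono)
      have "R \<le> (C + 1) * (real n + 1)"
        using R(3) \<open>C > 0\<close> by (simp add: algebra_simps)
      then show "R / A\<^sup>2 \<le> C + 1"
        unfolding A(2) by (simp add: divide_le_eq)
    qed simp
    finally have "real L * A * exp (R / (2 * \<sigma>\<^sup>2 * A\<^sup>2)) \<le> real L * A * exp ((C + 1) / (2 * \<sigma>\<^sup>2))"
      using A by (intro mult_left_mono) auto
    moreover have "R / (2 * \<sigma>\<^sup>2) \<le> rad_sq n S / (2 * \<sigma>\<^sup>2) + 1 / (2 * \<sigma>\<^sup>2)"
      using divide_right_mono[OF R(2), of "2 * \<sigma>\<^sup>2"] by (simp add: add_divide_distrib)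
    ultimately have "- (rad_sq n S / (2 * \<sigma>\<^sup>2)) - r n
        \<le> - ln (real L) + (- (R / (2 * \<sigma>\<^sup>2)) - real L * A * exp (R / (2 * \<sigma>\<^sup>2 * A\<^sup>2)))"
      by (simp add: r_def A_def mult_ac)
    then have "exp (- (rad_sq n S / (2 * \<sigma>\<^sup>2)) - r n)
        \<le> exp (- ln (real L)) * exp (- (R / (2 * \<sigma>\<^sup>2)) - real L * A * exp (R / (2 * \<sigma>\<^sup>2 * A\<^sup>2)))"
      by (simp only: exp_add[symmetric] exp_le_cancel_iff)
    also have "\<dots> \<le> exp (- ln (real L)) * (\<Sum>x\<in>S. P_ML n \<sigma> x S)"
      using sum_P_ML_ge[OF \<open>\<sigma> > 0\<close> A(1) S(1,2) \<open>S \<noteq> {}\<close> R(1)] S(3)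
      by (intro mult_left_mono) auto
    also have "\<dots> = P_ML_avg n \<sigma> S"
      using S(3) \<open>L \<ge> 2\<close> by (simp add: P_ML_avg_def exp_minus inverse_eq_divide)
    finally show ?thesis .
  qed
  ultimately show ?thesis by blast
qed

end
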